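(* Let $A$ and $B$ be singular real symmetric $n\times n$ matrices, and let $U$ be a nonsingular real $n\times n$ matrix such that $$U^TAU=\begin{pmatrix}A_1&0_{p\times(n-p)}\\0_{(n-p)\times p}&0_{n-p}\end{pmatrix},\qquad U^TBU=\begin{pmatrix}\mathcal{B}_1&0_{p\times q}&\mathcal{B}_2\\0_{q\times p}&\mathcal{B}_3&0_{q\times r}\\\mathcal{B}_2^T&0_{r\times q}&0_r\end{pmatrix},$$ where $p,q,r\ge 0$, $p+q+r=n$, $A_1$ is a $p\times p$ nonsingular diagonal matrix, $\mathcal{B}_1$ is a $p\times p$ matrix, $\mathcal{B}_2$ is a $p\times r$ matrix, and $\mathcal{B}_3$ is a $q\times q$ nonsingular diagonal matrix. Then $A$ and $B$ are simultaneously diagonalizable via congruence if and only if the Jordan normal form of $A_1^{-1}\mathcal{B}_1$ is diagonal (i.e. $A_1^{-1}\mathcal{B}_1$ is similar over $\mathbb{R}$ to a real diagonal matrix) and either $\mathcal{B}_2$ is a zero matrix or $r=0$ (so that $\mathcal{B}_2$ does not exist).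
   Context: Real symmetric $n\times n$ matrices $M_1,\dots,M_k$ are called simultaneously diagonalizable via congruence (SD) if there exists a nonsingular real $n\times n$ matrix $P$ such that $P^TM_iP$ is diagonal for every $i=1,\dots,k$. $0_{a\times b}$ and $0_a$ denote the zero matrices of size $a\times b$ and $a\times a$. All matrices are real. When $p=0$ the blocks $A_1$, $\mathcal{B}_1$ are empty and the Jordan-form condition is vacuous. *)

theory Defs
  imports
    "Jordan_Normal_Form.Jordan_Normal_Form"
    "Jordan_Normal_Form.Gauss_Jordan_Elimination"
    Complex_Main
begin

text \<open>Matrices are those of \<open>Jordan_Normal_Form.Matrix\<close>, whose sizes are natural numbers and
  may be 0, so the blocks below may be empty.\<close>

definition simultaneously_diagonalizable_via_congruence :: "nat \<Rightarrow> real mat set \<Rightarrow> bool" where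
  "simultaneously_diagonalizable_via_congruence n \<M> \<longleftrightarrow>
     (\<exists>P \<in> carrier_mat n n. invertible_mat P \<and>
        (\<forall>M \<in> \<M>. diagonal_mat (transpose_mat P * M * P)))"

text \<open>The Jordan form is taken over the reals: all eigenvalues occurring in it are real.
  The lemma \<open>has_diagonal_jordan_nf_iff\<close> relates this to similarity to a diagonal matrix.\<close>

definition has_diagonal_jordan_nf :: "real mat \<Rightarrow> bool" where
  "has_diagonal_jordan_nf M \<longleftrightarrow>
     (\<exists>n_as. jordan_nf M n_as \<and> diagonal_mat (jordan_matrix n_as))"

lemma jordan_matrix_blocks_1:
  "jordan_matrix (map (Pair 1) ds) =
     mat (length ds) (length ds) (\<lambda>(i, j). if i = j then ds ! i else 0)"
proof (induction ds)
  case Nil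
  then show ?case by (auto simp: jordan_matrix_def)
next
  case (Cons d ds)
  have len: "sum_list (map fst (map (Pair 1) ds)) = length ds"
    by (induction ds) auto
  have "jordan_matrix (map (Pair 1) (d # ds)) =
      four_block_mat (jordan_block 1 d) (0\<^sub>m 1 (length ds)) (0\<^sub>m (length ds) 1)
        (mat (length ds) (length ds) (\<lambda>(i, j). if i = j then ds ! i else 0))"
    by (simp only: list.map jordan_matrix_Cons len Cons.IH)
  also have "\<dots> = mat (length (d # ds)) (length (d # ds)) (\<lambda>(i, j). if i = j then (d # ds) ! i else 0)"
    by (rule eq_matI) (auto simp: nth_Cons')
  finally show ?case .
qed

lemma has_diagonal_jordan_nf_iff:
  "has_diagonal_jordan_nf M \<longleftrightarrow> (\<exists>D. diagonal_mat D \<and> similar_mat M D)"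
proof
  assume "\<exists>D. diagonal_mat D \<and> similar_mat M D"
  then obtain D where D: "diagonal_mat D" "similar_mat M D" by blast
  then obtain n where n: "D \<in> carrier_mat n n"
    using similar_matD by blast
  have eq: "jordan_matrix (map (Pair 1) (map (\<lambda>i. D $$ (i, i)) [0..<n])) = D"
    unfolding jordan_matrix_blocks_1
    by (rule eq_matI) (use n D in \<open>auto simp: diagonal_mat_def\<close>)
  then have "jordan_nf M (map (Pair 1) (map (\<lambda>i. D $$ (i, i)) [0..<n]))"
    unfolding jordan_nf_def eq using D by auto
  with eq D show "has_diagonal_jordan_nf M"
    unfolding has_diagonal_jordan_nf_def by metis
qed (auto simp: has_diagonal_jordan_nf_def jordan_nf_def)

end

theory Submission
  imports Defs
begin

text \<open>Simultaneous diagonalizability is invariant under congruence, so \<open>A\<close> and \<open>B\<close> may be taken in their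
  block forms \<open>U\<^sup>T A U\<close> and \<open>U\<^sup>T B U\<close> (\<open>simultaneously_diagonalizable_congruence_iff\<close>).

  If \<open>D = P\<^sup>T A P\<close> and \<open>E = P\<^sup>T B P\<close> are diagonal with entries \<open>\<delta>\<^sub>i\<close> and \<open>\<epsilon>\<^sub>i\<close>, then the columns of \<open>P\<close>
  satisfy \<open>\<epsilon>\<^sub>i A v\<^sub>i = \<delta>\<^sub>i B v\<^sub>i\<close> (\<open>diagonal_congruence_pencil\<close>). Let \<open>x\<^sub>i\<close> consist of the first \<open>p\<close>
  coordinates of \<open>v\<^sub>i\<close>; these vectors span the space of dimension \<open>p\<close> because \<open>P\<close> is invertible. Those
  with \<open>\<delta>\<^sub>i = 0\<close> vanish, since \<open>A v\<^sub>i = 0\<close> and \<open>A\<^sub>1\<close> is invertible. For the others the last block row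
  of \<open>B\<close> gives \<open>B\<^sub>2\<^sup>T x\<^sub>i = 0\<close>. By spanning, \<open>B\<^sub>2 = 0\<close>, and then the first block row makes \<open>x\<^sub>i\<close> an
  eigenvector of \<open>A\<^sub>1\<inverse> B\<^sub>1\<close>. So this matrix has enough real eigenvectors to be diagonalizable
  (\<open>diagonalizable_if_simultaneous_congruence\<close>, \<open>diagonalizable_if_eigenvectors\<close>).

  Conversely, let \<open>B\<^sub>2 = 0\<close> and \<open>A\<^sub>1\<inverse> B\<^sub>1 = S L S\<inverse>\<close> with \<open>L\<close> diagonal. Only \<open>A\<^sub>1\<close> and \<open>B\<^sub>1\<close> have to be
  diagonalized, as the remaining blocks are diagonal. The symmetric matrix \<open>C = S\<^sup>T A\<^sub>1 S\<close> commutes with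
  \<open>L\<close> because \<open>C L = S\<^sup>T B\<^sub>1 S\<close> is symmetric as well. Lagrange's reduction of \<open>C\<close> uses only row and column
  operations between indices that \<open>C\<close> couples, hence between equal entries of \<open>L\<close>; it is a congruence
  by a matrix commuting with \<open>L\<close> (\<open>symmetric_congruent_diagonal\<close>) and diagonalizes \<open>C L\<close> together with
  \<open>C\<close> (\<open>simultaneous_congruence_if_diagonalizable\<close>).\<close>

section \<open>Inverses, diagonal matrices and congruence\<close>

lemma invertible_mat_obtain_inverse:
  assumes "A \<in> carrier_mat n n" "invertible_mat A"
  obtains B where "B \<in> carrier_mat n n" "A * B = 1\<^sub>m n" "B * A = 1\<^sub>m n"
proof -
  obtain B where B: "A * B = 1\<^sub>m (dim_row A)" "B * A = 1\<^sub>m (dim_row B)"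
    using assms(2) unfolding invertible_mat_def inverts_mat_def by blast
  have "dim_col (A * B) = dim_col (1\<^sub>m n :: 'a mat)" "dim_col (B * A) = dim_col (1\<^sub>m (dim_row B) :: 'a mat)"
    using B assms(1) by auto
  then have "B \<in> carrier_mat n n" using assms(1) by auto
  then show ?thesis using that B assms(1) by auto
qed

lemma invertible_mat_if_inverse:
  assumes "A \<in> carrier_mat n n" "B \<in> carrier_mat n n" "A * B = 1\<^sub>m n" "B * A = 1\<^sub>m n"
  shows "invertible_mat A"
  using assms unfolding invertible_mat_def inverts_mat_def by auto

lemma the_mat_inverse:
  fixes A :: "'a :: field mat"
  assumes "A \<in> carrier_mat n n" "invertible_mat A"
  shows "the (mat_inverse A) \<in> carrier_mat n n"
    "A * the (mat_inverse A) = 1\<^sub>m n" "the (mat_inverse A) * A = 1\<^sub>m n"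
proof -
  obtain B where "B \<in> carrier_mat n n" "A * B = 1\<^sub>m n" "B * A = 1\<^sub>m n"
    using invertible_mat_obtain_inverse[OF assms] .
  then have "A \<in> Units (ring_mat TYPE('a) n ())"
    using assms(1) unfolding Units_def ring_mat_def by auto
  then obtain C where "mat_inverse A = Some C"
    using mat_inverse(1)[OF assms(1)] by fastforce
  then show "the (mat_inverse A) \<in> carrier_mat n n"
    "A * the (mat_inverse A) = 1\<^sub>m n" "the (mat_inverse A) * A = 1\<^sub>m n"
    using mat_inverse(2)[OF assms(1)] by auto
qed

text \<open>Exhibits the entry as a sum over indices instead of a scalar product of a row and a column, so
  that the sum can be restricted, reindexed or swapped.\<close>

lemma index_mult_mat_sum:
  assumes "A \<in> carrier_mat m n" "B \<in> carrier_mat n k" "i < m" "j < k"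
  shows "(A * B) $$ (i, j) = (\<Sum>a = 0..<n. A $$ (i, a) * B $$ (a, j))"
  using assms by (auto simp: scalar_prod_def)

lemma diagonal_mult_index:
  fixes D :: "'a :: semiring_0 mat"
  assumes "D \<in> carrier_mat n n" "diagonal_mat D" "A \<in> carrier_mat m n" "i < m" "j < n"
  shows "(A * D) $$ (i, j) = A $$ (i, j) * D $$ (j, j)"
proof -
  have "(A * D) $$ (i, j) = (\<Sum>a = 0..<n. A $$ (i, a) * D $$ (a, j))"
    using assms by (intro index_mult_mat_sum) auto
  also have "\<dots> = (\<Sum>a = 0..<n. if a = j then A $$ (i, j) * D $$ (j, j) else 0)"
    using assms by (intro sum.cong) (auto simp: diagonal_mat_def)
  finally show ?thesis using assms by simp
qed

lemma mult_diagonal_index: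
  fixes D :: "'a :: semiring_0 mat"
  assumes "D \<in> carrier_mat n n" "diagonal_mat D" "A \<in> carrier_mat n m" "i < n" "j < m"
  shows "(D * A) $$ (i, j) = D $$ (i, i) * A $$ (i, j)"
proof -
  have "(D * A) $$ (i, j) = (\<Sum>a = 0..<n. D $$ (i, a) * A $$ (a, j))"
    using assms by (intro index_mult_mat_sum) auto
  also have "\<dots> = (\<Sum>a = 0..<n. if a = i then D $$ (i, i) * A $$ (i, j) else 0)"
    using assms by (intro sum.cong) (auto simp: diagonal_mat_def)
  finally show ?thesis using assms by simp
qed

lemma commutes_with_diagonal_iff:
  fixes D :: "'a :: comm_semiring_0 mat"
  assumes "D \<in> carrier_mat n n" "diagonal_mat D" "X \<in> carrier_mat n n"
  shows "X * D = D * X \<longleftrightarrow> (\<forall>i<n. \<forall>j<n. X $$ (i, j) * D $$ (j, j) = D $$ (i, i) * X $$ (i, j))"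
proof
  assume "X * D = D * X"
  then show "\<forall>i<n. \<forall>j<n. X $$ (i, j) * D $$ (j, j) = D $$ (i, i) * X $$ (i, j)"
    using assms diagonal_mult_index[OF assms] mult_diagonal_index[OF assms]
    by (auto simp del: index_mult_mat(1))
next
  assume r: "\<forall>i<n. \<forall>j<n. X $$ (i, j) * D $$ (j, j) = D $$ (i, i) * X $$ (i, j)"
  show "X * D = D * X"
  proof (rule eq_matI)
    fix i j assume "i < dim_row (D * X)" "j < dim_col (D * X)"
    then have "i < n" "j < n" using assms by auto
    then show "(X * D) $$ (i, j) = (D * X) $$ (i, j)"
      using r assms diagonal_mult_index[of D n X n i j] mult_diagonal_index[of D n X n i j] by simp
  qed (use assms in auto)
qed

lemma diagonal_mat_commute:
  fixes D E :: "'a :: comm_semiring_0 mat"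
  assumes "D \<in> carrier_mat n n" "diagonal_mat D" "E \<in> carrier_mat n n" "diagonal_mat E"
  shows "D * E = E * D"
proof -
  have "D $$ (i, j) * E $$ (j, j) = E $$ (i, i) * D $$ (i, j)" if "i < n" "j < n" for i j
    using that assms(1,2) by (cases "i = j") (simp_all add: diagonal_mat_def mult.commute)
  then show ?thesis
    unfolding commutes_with_diagonal_iff[OF assms(3,4,1)] by blast
qed

lemma diagonal_mat_mult:
  fixes D E :: "'a :: semiring_0 mat"
  assumes "D \<in> carrier_mat n n" "diagonal_mat D" "E \<in> carrier_mat n n" "diagonal_mat E"
  shows "diagonal_mat (D * E)"
  using assms diagonal_mult_index[of E n D n] unfolding diagonal_mat_def
  by (auto simp del: index_mult_mat(1))

lemma diagonal_mat_transpose: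
  assumes "D \<in> carrier_mat n n" "diagonal_mat D"
  shows "transpose_mat D = D"
proof (rule eq_matI)
  fix i j assume "i < dim_row D" "j < dim_col D"
  then show "transpose_mat D $$ (i, j) = D $$ (i, j)"
    using assms by (cases "i = j") (simp_all add: diagonal_mat_def)
qed (use assms in auto)

lemma congruence_congruence:
  assumes "X \<in> carrier_mat n n" "Y \<in> carrier_mat n n" "C \<in> carrier_mat n n"
  shows "transpose_mat Y * (transpose_mat X * C * X) * Y = transpose_mat (X * Y) * C * (X * (Y :: 'a :: comm_ring_1 mat))"
  using assms by (simp add: transpose_mult[of _ n n _ n] assoc_mult_mat[of _ n n _ n _ n])

lemma mult_inverse_mult:
  assumes "X \<in> carrier_mat n n" "Y \<in> carrier_mat n n" "X' \<in> carrier_mat n n" "Y' \<in> carrier_mat n n"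
    and "X * X' = 1\<^sub>m n" "Y * Y' = 1\<^sub>m n"
  shows "(X * Y) * (Y' * X') = (1\<^sub>m n :: 'a :: comm_ring_1 mat)"
proof -
  have "(X * Y) * (Y' * X') = X * (Y * Y') * X'"
    using assms(1-4) by (simp add: assoc_mult_mat[of _ n n _ n _ n])
  then show ?thesis using assms by simp
qed

text \<open>This allows the matrices to be replaced by their block forms: if \<open>P\<close> works for the
  matrices \<open>U\<^sup>T M U\<close>, then \<open>U P\<close> works for the matrices \<open>M\<close>, and conversely with the
  inverse of \<open>U\<close>.\<close>

lemma simultaneously_diagonalizable_congruence_iff:
  assumes U: "U \<in> carrier_mat n n" "invertible_mat U" and Ms: "\<M> \<subseteq> carrier_mat n n"
  shows "simultaneously_diagonalizable_via_congruence n ((\<lambda>M. transpose_mat U * M * U) ` \<M>) \<longleftrightarrow>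
    simultaneously_diagonalizable_via_congruence n \<M>"
proof -
  obtain V where V: "V \<in> carrier_mat n n" "U * V = 1\<^sub>m n" "V * U = 1\<^sub>m n"
    using invertible_mat_obtain_inverse[OF U] .
  \<comment> \<open>Stated for an arbitrary factor \<open>Y\<close>, since it serves for both \<open>U\<close> and its inverse.\<close>
  have inv: "invertible_mat (Y * P)"
    if Y: "Y \<in> carrier_mat n n" "Y' \<in> carrier_mat n n" "Y * Y' = 1\<^sub>m n" "Y' * Y = 1\<^sub>m n"
      and P: "P \<in> carrier_mat n n" "invertible_mat P" for Y Y' P :: "real mat"
  proof -
    obtain Q where Q: "Q \<in> carrier_mat n n" "P * Q = 1\<^sub>m n" "Q * P = 1\<^sub>m n"
      using invertible_mat_obtain_inverse[OF P] .
    show ?thesis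
      using mult_inverse_mult[OF Y(1) P(1) Y(2) Q(1) Y(3) Q(2)] mult_inverse_mult[OF Q(1) Y(2) P(1) Y(1) Q(3) Y(4)]
        Y(1,2) P(1) Q(1)
      by (intro invertible_mat_if_inverse[of "Y * P" n "Q * Y'"]) auto
  qed
  show ?thesis
  proof
    assume "simultaneously_diagonalizable_via_congruence n ((\<lambda>M. transpose_mat U * M * U) ` \<M>)"
    then obtain P where P: "P \<in> carrier_mat n n" "invertible_mat P"
      "\<And>M. M \<in> \<M> \<Longrightarrow> diagonal_mat (transpose_mat P * (transpose_mat U * M * U) * P)"
      unfolding simultaneously_diagonalizable_via_congruence_def by blast
    have "diagonal_mat (transpose_mat (U * P) * M * (U * P))" if "M \<in> \<M>" for M
      using P(3)[OF that] congruence_congruence[OF U(1) P(1), of M] Ms that by auto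
    then show "simultaneously_diagonalizable_via_congruence n \<M>"
      unfolding simultaneously_diagonalizable_via_congruence_def
      using inv[OF U(1) V P(1,2)] mult_carrier_mat[OF U(1) P(1)] by blast
  next
    assume "simultaneously_diagonalizable_via_congruence n \<M>"
    then obtain P where P: "P \<in> carrier_mat n n" "invertible_mat P"
      "\<And>M. M \<in> \<M> \<Longrightarrow> diagonal_mat (transpose_mat P * M * P)"
      unfolding simultaneously_diagonalizable_via_congruence_def by blast
    have "U * (V * P) = (U * V) * P" using U(1) V(1) P(1) by simp
    then have UVP: "U * (V * P) = P" using V(2) P(1) by simp
    have "transpose_mat (V * P) * (transpose_mat U * M * U) * (V * P) = transpose_mat P * M * P"
      if "M \<in> \<M>" for M
      using congruence_congruence[OF U(1) mult_carrier_mat[OF V(1) P(1)], of M] Ms that UVP by auto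
    then show "simultaneously_diagonalizable_via_congruence n ((\<lambda>M. transpose_mat U * M * U) ` \<M>)"
      unfolding simultaneously_diagonalizable_via_congruence_def
      using inv[OF V(1) U(1) V(3,2) P(1,2)] mult_carrier_mat[OF V(1) P(1)] P(3)
      by (intro bexI[of _ "V * P"]) auto
  qed
qed

section \<open>Lagrange reduction inside a centralizer\<close>

text \<open>The matrix \<open>I + e\<^sub>i u\<^sup>T\<close>. As a congruence it adds \<open>u\<^sub>b\<close> times row and column \<open>i\<close> to row and
  column \<open>b\<close>, for all \<open>b\<close> at once, so one such matrix clears a whole row and column.\<close>

definition transvection :: "nat \<Rightarrow> nat \<Rightarrow> (nat \<Rightarrow> 'a) \<Rightarrow> 'a :: comm_ring_1 mat" where
  "transvection n i u = mat n n (\<lambda>(a, b). (if a = b then 1 else 0) + (if a = i then u b else 0))"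

lemma transvection_carrier [simp]: "transvection n i u \<in> carrier_mat n n"
  by (simp add: transvection_def)

lemma mult_transvection_index:
  assumes "M \<in> carrier_mat n n" "i < n" "a < n" "b < n"
  shows "(M * transvection n i u) $$ (a, b) = M $$ (a, b) + M $$ (a, i) * u b"
proof -
  have "(M * transvection n i u) $$ (a, b)
      = (\<Sum>k = 0..<n. M $$ (a, k) * ((if k = b then 1 else 0) + (if k = i then u b else 0)))"
    using assms by (subst index_mult_mat_sum[of _ n n _ n]) (auto simp: transvection_def)
  also have "\<dots> = (\<Sum>k = 0..<n. (if k = b then M $$ (a, b) else 0)
      + (if k = i then M $$ (a, i) * u b else 0))"
    by (intro sum.cong) (auto simp: algebra_simps)
  finally show ?thesis using assms by (simp add: sum.distrib)
qed

text \<open>Since \<open>u\<^sup>T e\<^sub>i = u\<^sub>i = 0\<close>, the quadratic term of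
  \<open>(I + e\<^sub>i u\<^sup>T) (I - e\<^sub>i u\<^sup>T)\<close> vanishes.\<close>

lemma transvection_mult_uminus:
  assumes "i < n" "u i = 0"
  shows "transvection n i u * transvection n i (\<lambda>k. - u k) = 1\<^sub>m n"
proof (rule eq_matI)
  fix a b assume "a < dim_row (1\<^sub>m n :: 'a mat)" "b < dim_col (1\<^sub>m n :: 'a mat)"
  then show "(transvection n i u * transvection n i (\<lambda>k. - u k)) $$ (a, b) = 1\<^sub>m n $$ (a, b)"
    using assms mult_transvection_index[of "transvection n i u" n i a b "\<lambda>k. - u k"]
    by (auto simp: transvection_def)
qed (auto simp: transvection_def)

lemma transvection_congruence_index:
  assumes "M \<in> carrier_mat n n" "i < n" "a < n" "b < n"
  shows "(transpose_mat (transvection n i u) * M * transvection n i u) $$ (a, b)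
    = M $$ (a, b) + u a * M $$ (i, b) + M $$ (a, i) * u b + u a * M $$ (i, i) * u b"
proof -
  let ?T = "transvection n i u"
  have l: "(transpose_mat ?T * M) $$ (a, c) = M $$ (a, c) + u a * M $$ (i, c)" if "c < n" for c
  proof -
    have "transpose_mat ?T * M = transpose_mat (transpose_mat M * ?T)"
      using assms by (subst transpose_mult[of _ n n _ n]) auto
    then have "(transpose_mat ?T * M) $$ (a, c) = (transpose_mat M * ?T) $$ (c, a)"
      using assms that by (simp add: transvection_def)
    also have "\<dots> = M $$ (a, c) + u a * M $$ (i, c)"
      using assms that by (subst mult_transvection_index) (auto simp: mult.commute)
    finally show ?thesis .
  qed
  have "(transpose_mat ?T * M * ?T) $$ (a, b)
      = (transpose_mat ?T * M) $$ (a, b) + (transpose_mat ?T * M) $$ (a, i) * u b"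
    using assms by (intro mult_transvection_index mult_carrier_mat[of _ n n]) auto
  then show ?thesis using assms l by (simp add: algebra_simps)
qed

text \<open>Congruence by elements of the centralizer of \<open>L\<close>. If \<open>L\<close> is diagonal, these are the invertible
  matrices that are block diagonal with respect to the partition of the indices by the value of
  the diagonal entry of \<open>L\<close>. Commutation with \<open>L\<close> replaces an explicit sorting of the indices
  into blocks.\<close>

definition congruent_commuting :: "nat \<Rightarrow> 'a :: comm_ring_1 mat \<Rightarrow> 'a mat \<Rightarrow> 'a mat \<Rightarrow> bool" where
  "congruent_commuting n L C C' \<longleftrightarrow>
     (\<exists>X\<in>carrier_mat n n. \<exists>Y\<in>carrier_mat n n. X * Y = 1\<^sub>m n \<and> Y * X = 1\<^sub>m n \<and>
        X * L = L * X \<and> C' = transpose_mat X * C * X)"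

lemma congruent_commuting_refl:
  assumes "C \<in> carrier_mat n n" "L \<in> carrier_mat n n"
  shows "congruent_commuting n L C C"
  unfolding congruent_commuting_def using assms
  by (intro bexI[of _ "1\<^sub>m n"]) auto

lemma congruent_commuting_trans:
  assumes "congruent_commuting n L C C'" "congruent_commuting n L C' C''"
    and C: "C \<in> carrier_mat n n" and L: "L \<in> carrier_mat n n"
  shows "congruent_commuting n L C C''"
proof -
  obtain X X' where X: "X \<in> carrier_mat n n" "X' \<in> carrier_mat n n" "X * X' = 1\<^sub>m n" "X' * X = 1\<^sub>m n"
    "X * L = L * X" "C' = transpose_mat X * C * X"
    using assms(1) unfolding congruent_commuting_def by blast
  obtain Y Y' where Y: "Y \<in> carrier_mat n n" "Y' \<in> carrier_mat n n" "Y * Y' = 1\<^sub>m n" "Y' * Y = 1\<^sub>m n"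
    "Y * L = L * Y" "C'' = transpose_mat Y * C' * Y"
    using assms(2) unfolding congruent_commuting_def by blast
  have "X * Y * L = X * (Y * L)"
    using X(1) Y(1) L by (simp add: assoc_mult_mat[of _ n n _ n _ n])
  also have "\<dots> = X * L * Y"
    unfolding Y(5) using X(1) Y(1) L by (simp add: assoc_mult_mat[of _ n n _ n _ n])
  also have "\<dots> = L * (X * Y)"
    unfolding X(5) using X(1) Y(1) L by (simp add: assoc_mult_mat[of _ n n _ n _ n])
  finally have "X * Y * L = L * (X * Y)" .
  moreover have "C'' = transpose_mat (X * Y) * C * (X * Y)"
    unfolding Y(6) X(6) by (rule congruence_congruence[OF X(1) Y(1) C])
  moreover note mult_inverse_mult[OF X(1) Y(1) X(2) Y(2) X(3) Y(3)]
    mult_inverse_mult[OF Y(2) X(2) Y(1) X(1) Y(4) X(4)]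
    mult_carrier_mat[OF X(1) Y(1)] mult_carrier_mat[OF Y(2) X(2)]
  ultimately show ?thesis
    unfolding congruent_commuting_def by blast
qed

lemma congruent_commuting_preserves:
  assumes "congruent_commuting n L C C'"
    and C: "C \<in> carrier_mat n n" "transpose_mat C = C" "C * L = L * C"
    and L: "L \<in> carrier_mat n n" "transpose_mat L = L"
  shows "C' \<in> carrier_mat n n" "transpose_mat C' = C'" "C' * L = L * C'"
proof -
  obtain X where X: "X \<in> carrier_mat n n" "X * L = L * X" "C' = transpose_mat X * C * X"
    using assms(1) unfolding congruent_commuting_def by blast
  show "C' \<in> carrier_mat n n" using X C by auto
  show "transpose_mat C' = C'"
    using X(1,3) C(1,2) by (simp add: transpose_mult[of _ n n _ n] assoc_mult_mat[of _ n n _ n _ n])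
  \<comment> \<open>As \<open>L\<close> is symmetric, its centralizer is closed under transposition.\<close>
  have "transpose_mat X * L = transpose_mat (L * X)"
    using X(1) L by (simp add: transpose_mult[of _ n n _ n])
  also have "\<dots> = transpose_mat (X * L)" using X(2) by simp
  also have "\<dots> = L * transpose_mat X"
    using X(1) L by (simp add: transpose_mult[of _ n n _ n])
  finally have XT: "transpose_mat X * L = L * transpose_mat X" .
  have "C' * L = transpose_mat X * C * (X * L)"
    using X(1,3) C(1) L by (simp add: assoc_mult_mat[of _ n n _ n _ n])
  also have "\<dots> = transpose_mat X * (C * L) * X"
    unfolding X(2) using X(1) C(1) L by (simp add: assoc_mult_mat[of _ n n _ n _ n])
  also have "\<dots> = (transpose_mat X * L) * C * X"
    unfolding C(3) using X(1) C(1) L by (simp add: assoc_mult_mat[of _ n n _ n _ n])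
  also have "\<dots> = L * C'"
    unfolding XT X(3) using X(1) C(1) L by (simp add: assoc_mult_mat[of _ n n _ n _ n])
  finally show "C' * L = L * C'" .
qed

text \<open>A transvection that mixes only indices with equal diagonal entries of \<open>L\<close> commutes with \<open>L\<close>.\<close>

lemma congruent_commuting_transvection:
  fixes C L :: "'a :: idom mat"
  assumes "C \<in> carrier_mat n n" "L \<in> carrier_mat n n" "diagonal_mat L" "i < n" "u i = 0"
    and u: "\<And>b. b < n \<Longrightarrow> u b \<noteq> 0 \<Longrightarrow> L $$ (b, b) = L $$ (i, i)"
  shows "congruent_commuting n L C (transpose_mat (transvection n i u) * C * transvection n i u)"
proof -
  have "u b * L $$ (b, b) = L $$ (i, i) * u b" if "b < n" for b
    using u[OF that] by (cases "u b = 0") (simp_all add: mult.commute)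
  then have "transvection n i u * L = L * transvection n i u"
    unfolding commutes_with_diagonal_iff[OF assms(2,3) transvection_carrier] using assms(4,5)
    by (simp add: transvection_def distrib_left distrib_right)
  moreover have "transvection n i (\<lambda>k. - u k) * transvection n i u = 1\<^sub>m n"
    using transvection_mult_uminus[of i n "\<lambda>k. - u k"] assms by simp
  ultimately show ?thesis
    unfolding congruent_commuting_def
    using assms transvection_mult_uminus[of i n u]
    by (intro bexI[of _ "transvection n i u"] bexI[of _ "transvection n i (\<lambda>k. - u k)"]) auto
qed

text \<open>The indices that Lagrange's reduction still has to treat. Their number is the termination
  measure, which makes it unnecessary to move the treated indices to the front.\<close>

definition coupled_indices :: "nat \<Rightarrow> 'a :: zero mat \<Rightarrow> nat set" where
  "coupled_indices n C = {a. a < n \<and> (\<exists>b<n. a \<noteq> b \<and> C $$ (a, b) \<noteq> 0)}"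

text \<open>If \<open>C\<^sub>i\<^sub>i = C\<^sub>j\<^sub>j = 0\<close> but \<open>C\<^sub>i\<^sub>j \<noteq> 0\<close>, then adding row and column \<open>j\<close> to row and column \<open>i\<close> puts
  \<open>2 C\<^sub>i\<^sub>j\<close> at the place \<open>(i, i)\<close>, which is nonzero in characteristic 0. The addition commutes
  with \<open>L\<close>, because \<open>C\<close> does and therefore \<open>C\<^sub>i\<^sub>j \<noteq> 0\<close> forces \<open>L\<^sub>i\<^sub>i = L\<^sub>j\<^sub>j\<close>.\<close>

lemma congruent_commuting_nonzero_pivot:
  fixes C L :: "'a :: field_char_0 mat"
  assumes C: "C \<in> carrier_mat n n" "transpose_mat C = C" "C * L = L * C"
    and L: "L \<in> carrier_mat n n" "diagonal_mat L"
    and ij: "i < n" "j < n" "i \<noteq> j" "C $$ (i, j) \<noteq> 0"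
  obtains C' k where "congruent_commuting n L C C'" "coupled_indices n C' \<subseteq> coupled_indices n C"
    "k \<in> coupled_indices n C" "C' $$ (k, k) \<noteq> 0"
proof -
  have sym: "C $$ (a, b) = C $$ (b, a)" if "a < n" "b < n" for a b
    using that C(1) arg_cong[OF C(2), of "\<lambda>M. M $$ (a, b)"] by simp
  have ci: "i \<in> coupled_indices n C" and cj: "j \<in> coupled_indices n C"
    using ij sym[of i j] unfolding coupled_indices_def by auto
  show ?thesis
  proof (cases "C $$ (i, i) = 0 \<and> C $$ (j, j) = 0")
    case False
    then show ?thesis
      using that[of C i] that[of C j] ci cj congruent_commuting_refl[OF C(1) L(1)] by auto
  next
    case True
    define u :: "nat \<Rightarrow> 'a" where "u b = (if b = i then 1 else 0)" for b
    let ?C = "transpose_mat (transvection n j u) * C * transvection n j u"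
    have idx: "?C $$ (a, b) = C $$ (a, b) + u a * C $$ (j, b) + C $$ (a, j) * u b" if "a < n" "b < n" for a b
      using transvection_congruence_index[OF C(1) ij(2) that] True by simp
    have "C $$ (i, j) * L $$ (j, j) = L $$ (i, i) * C $$ (i, j)"
      using C(3) ij(1,2) unfolding commutes_with_diagonal_iff[OF L C(1)] by blast
    then have "L $$ (i, i) = L $$ (j, j)"
      using ij(4) by simp
    then have "congruent_commuting n L C ?C"
      using C(1) L ij by (intro congruent_commuting_transvection) (auto simp: u_def split: if_splits)
    moreover have "coupled_indices n ?C \<subseteq> coupled_indices n C"
    proof
      fix a assume "a \<in> coupled_indices n ?C"
      then obtain b where ab: "a < n" "b < n" "a \<noteq> b" "?C $$ (a, b) \<noteq> 0"
        unfolding coupled_indices_def by blast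
      show "a \<in> coupled_indices n C"
      proof (rule ccontr)
        assume no: "a \<notin> coupled_indices n C"
        then have "a \<noteq> i" "a \<noteq> j" "\<And>c. c < n \<Longrightarrow> a \<noteq> c \<Longrightarrow> C $$ (a, c) = 0"
          using ci cj ab(1) unfolding coupled_indices_def by auto
        then show False using idx[OF ab(1,2)] ab ij by (simp add: u_def)
      qed
    qed
    moreover have "?C $$ (i, i) \<noteq> 0"
      using idx[OF ij(1,1)] True sym[OF ij(1,2)] ij(4) by (simp add: u_def)
    ultimately show ?thesis using that ci by blast
  qed
qed

text \<open>Completing the square at a nonzero pivot \<open>C\<^sub>k\<^sub>k\<close> decouples the index \<open>k\<close>. An index that was already
  decoupled has \<open>u\<^sub>a = 0\<close> and keeps its row, so no new coupling arises.\<close>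

lemma congruent_commuting_eliminate:
  fixes C L :: "'a :: field mat"
  assumes C: "C \<in> carrier_mat n n" "transpose_mat C = C" "C * L = L * C"
    and L: "L \<in> carrier_mat n n" "diagonal_mat L"
    and k: "k < n" "C $$ (k, k) \<noteq> 0"
  obtains C' where "congruent_commuting n L C C'" "coupled_indices n C' \<subseteq> coupled_indices n C - {k}"
proof -
  have sym: "C $$ (a, b) = C $$ (b, a)" if "a < n" "b < n" for a b
    using that C(1) arg_cong[OF C(2), of "\<lambda>M. M $$ (a, b)"] by simp
  \<comment> \<open>This \<open>u\<close> solves \<open>C $$ (k, b) + C $$ (k, k) * u b = 0\<close> for \<open>b \<noteq> k\<close>.\<close>
  define u where "u b = (if b = k then 0 else - C $$ (k, b) / C $$ (k, k))" for b
  let ?C = "transpose_mat (transvection n k u) * C * transvection n k u"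
  have idx: "?C $$ (a, b) = C $$ (a, b) + u a * C $$ (k, b) + C $$ (a, k) * u b
      + u a * C $$ (k, k) * u b" if "a < n" "b < n" for a b
    using transvection_congruence_index[OF C(1) k(1) that] .
  have label: "L $$ (b, b) = L $$ (k, k)" if "b < n" "C $$ (k, b) \<noteq> 0" for b
  proof -
    have "C $$ (k, b) * L $$ (b, b) = L $$ (k, k) * C $$ (k, b)"
      using C(3) k(1) that(1) unfolding commutes_with_diagonal_iff[OF L C(1)] by blast
    then show ?thesis using that(2) by simp
  qed
  have "congruent_commuting n L C ?C"
  proof (rule congruent_commuting_transvection[OF C(1) L k(1)])
    fix b assume "b < n" "u b \<noteq> 0"
    then show "L $$ (b, b) = L $$ (k, k)"
      by (intro label) (auto simp: u_def split: if_splits)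
  qed (simp add: u_def)
  moreover have "coupled_indices n ?C \<subseteq> coupled_indices n C - {k}"
  proof
    fix a assume "a \<in> coupled_indices n ?C"
    then obtain b where ab: "a < n" "b < n" "a \<noteq> b" "?C $$ (a, b) \<noteq> 0"
      unfolding coupled_indices_def by blast
    have "a \<noteq> k"
    proof
      assume "a = k"
      then show False
        using ab(2-4) k unfolding idx[OF ab(1,2)] by (simp add: u_def)
    qed
    moreover have "a \<in> coupled_indices n C"
    proof (rule ccontr)
      assume no: "a \<notin> coupled_indices n C"
      then have z: "\<And>c. c < n \<Longrightarrow> a \<noteq> c \<Longrightarrow> C $$ (a, c) = 0"
        using ab(1) unfolding coupled_indices_def by auto
      have "C $$ (a, k) = 0" "C $$ (a, b) = 0"
        using z k(1) ab(2,3) \<open>a \<noteq> k\<close> by auto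
      moreover from this have "u a = 0"
        using sym[OF k(1) ab(1)] \<open>a \<noteq> k\<close> by (simp add: u_def)
      ultimately show False
        using ab(4) unfolding idx[OF ab(1,2)] by simp
    qed
    ultimately show "a \<in> coupled_indices n C - {k}" by blast
  qed
  ultimately show ?thesis using that by blast
qed

text \<open>Lagrange's reduction of a quadratic form, carried out inside the centralizer of \<open>L\<close>. It does not
  need square roots or orthogonality, so the spectral theorem is avoided.\<close>

lemma symmetric_congruent_diagonal:
  fixes C L :: "'a :: field_char_0 mat"
  assumes "C \<in> carrier_mat n n" "transpose_mat C = C" "C * L = L * C"
    and L: "L \<in> carrier_mat n n" "diagonal_mat L"
  obtains D where "congruent_commuting n L C D" "diagonal_mat D"
proof -
  have LT: "transpose_mat L = L"
    by (rule diagonal_mat_transpose[OF L])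
  have "\<exists>D. congruent_commuting n L C D \<and> diagonal_mat D"
    using assms(1-3)
  proof (induction "card (coupled_indices n C)" arbitrary: C rule: less_induct)
    case less
    have fin: "finite (coupled_indices n C)" unfolding coupled_indices_def by auto
    show ?case
    proof (cases "diagonal_mat C")
      case True
      then show ?thesis using congruent_commuting_refl less.prems L by blast
    next
      case False
      then obtain i j where ij: "i < n" "j < n" "i \<noteq> j" "C $$ (i, j) \<noteq> 0"
        using less.prems(1) unfolding diagonal_mat_def by auto
      obtain C1 k where C1: "congruent_commuting n L C C1"
        "coupled_indices n C1 \<subseteq> coupled_indices n C" "k \<in> coupled_indices n C" "C1 $$ (k, k) \<noteq> 0"
        using congruent_commuting_nonzero_pivot[OF less.prems L ij] .
      note C1' = congruent_commuting_preserves[OF C1(1) less.prems L(1) LT]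
      have "k < n" using C1(3) by (auto simp: coupled_indices_def)
      obtain C2 where C2: "congruent_commuting n L C1 C2"
        "coupled_indices n C2 \<subseteq> coupled_indices n C1 - {k}"
        using congruent_commuting_eliminate[OF C1' L \<open>k < n\<close> C1(4)] .
      note C2' = congruent_commuting_preserves[OF C2(1) C1' L(1) LT]
      have "card (coupled_indices n C2) < card (coupled_indices n C)"
        using C1 C2 fin by (intro psubset_card_mono) auto
      from less.hyps[OF this C2'] obtain D where D: "congruent_commuting n L C2 D" "diagonal_mat D"
        by blast
      show ?thesis
        using D congruent_commuting_trans[OF C1(1) congruent_commuting_trans[OF C2(1) D(1) C1'(1) L(1)] less.prems(1) L(1)]
        by blast
    qed
  qed
  then show ?thesis using that by blast
qed

section \<open>From a diagonalizable quotient to a simultaneous congruence\<close>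

text \<open>Let \<open>M = S D S\<inverse>\<close> and \<open>C = S\<^sup>T G S\<close>. Then \<open>C D = S\<^sup>T (G M) S\<close> is symmetric, which says that \<open>C\<close>
  and \<open>D\<close> commute. A congruence \<open>X\<close> that diagonalizes \<open>C\<close> and commutes with \<open>D\<close> therefore also
  diagonalizes \<open>C D\<close>, because \<open>X\<^sup>T C D X = (X\<^sup>T C X) D\<close>; the matrix sought is \<open>T = S X\<close>.\<close>

lemma simultaneous_congruence_if_diagonalizable:
  fixes G M :: "'a :: field_char_0 mat"
  assumes G: "G \<in> carrier_mat n n" "transpose_mat G = G"
    and M: "M \<in> carrier_mat n n" "transpose_mat (G * M) = G * M"
    and D: "diagonal_mat D" "similar_mat M D"
  obtains T T' where "T \<in> carrier_mat n n" "T' \<in> carrier_mat n n" "T * T' = 1\<^sub>m n" "T' * T = 1\<^sub>m n"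
    "diagonal_mat (transpose_mat T * G * T)" "diagonal_mat (transpose_mat T * (G * M) * T)"
proof -
  obtain m S S' where S0: "{M, D, S, S'} \<subseteq> carrier_mat m m" "S * S' = 1\<^sub>m m" "S' * S = 1\<^sub>m m" "M = S * D * S'"
    using similar_matD[OF D(2)] by blast
  have "m = n" using S0(1) M(1) by auto
  then have S: "S \<in> carrier_mat n n" "S' \<in> carrier_mat n n" "S * S' = 1\<^sub>m n" "S' * S = 1\<^sub>m n"
    and Dn: "D \<in> carrier_mat n n" using S0 by auto
  define C where "C = transpose_mat S * G * S"
  have C: "C \<in> carrier_mat n n" "transpose_mat C = C"
    unfolding C_def using G S(1)
    by (auto simp: transpose_mult[of _ n n _ n] assoc_mult_mat[of _ n n _ n _ n])
  have "M * S = S * D * (S' * S)"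
    unfolding S0(4) using S(1,2) Dn by (simp add: assoc_mult_mat[of _ n n _ n _ n])
  then have MS: "M * S = S * D" using S Dn by simp
  have CD: "C * D = transpose_mat S * (G * M) * S"
  proof -
    have "C * D = transpose_mat S * G * (S * D)"
      unfolding C_def using G(1) S(1) Dn by (simp add: assoc_mult_mat[of _ n n _ n _ n])
    also have "\<dots> = transpose_mat S * (G * M) * S"
      unfolding MS[symmetric] using G(1) S(1) M(1) by (simp add: assoc_mult_mat[of _ n n _ n _ n])
    finally show ?thesis .
  qed
  have DT: "transpose_mat D = D"
    using diagonal_mat_transpose[OF Dn D(1)] .
  have "C * D = D * C"
  proof -
    have "transpose_mat (C * D) = C * D"
      unfolding CD using M(2) G(1) M(1) S(1)
      by (simp add: transpose_mult[of _ n n _ n] assoc_mult_mat[of _ n n _ n _ n])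
    moreover have "transpose_mat (C * D) = D * C"
      using C Dn DT by (simp add: transpose_mult[of _ n n _ n])
    ultimately show ?thesis by simp
  qed
  then obtain E where E: "congruent_commuting n D C E" "diagonal_mat E"
    using symmetric_congruent_diagonal[OF C _ Dn D(1)] by blast
  obtain X X' where X: "X \<in> carrier_mat n n" "X' \<in> carrier_mat n n" "X * X' = 1\<^sub>m n" "X' * X = 1\<^sub>m n"
    "X * D = D * X" "E = transpose_mat X * C * X"
    using E(1) unfolding congruent_commuting_def by blast
  have En: "E \<in> carrier_mat n n" using X C by auto
  have "transpose_mat (S * X) * G * (S * X) = E"
    unfolding X(6) C_def using congruence_congruence[OF S(1) X(1) G(1)] by simp
  moreover have "transpose_mat (S * X) * (G * M) * (S * X) = E * D"
  proof -
    have "transpose_mat (S * X) * (G * M) * (S * X) = transpose_mat X * (C * D) * X"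
      unfolding CD using congruence_congruence[OF S(1) X(1), of "G * M"] G(1) M(1) by simp
    also have "\<dots> = transpose_mat X * C * (D * X)"
      using X(1) C(1) Dn by (simp add: assoc_mult_mat[of _ n n _ n _ n])
    also have "\<dots> = E * D"
      unfolding X(5)[symmetric] X(6) using X(1) C(1) Dn by (simp add: assoc_mult_mat[of _ n n _ n _ n])
    finally show ?thesis .
  qed
  ultimately show ?thesis
    using that[of "S * X" "X' * S'"] S X(1-4) E(2) diagonal_mat_mult[OF En E(2) Dn D(1)]
      mult_inverse_mult[of S n X S' X'] mult_inverse_mult[of X' n S' X S]
    by simp
qed

section \<open>From a simultaneous congruence to a diagonalizable quotient\<close>

text \<open>Comparing the traces of \<open>A B\<close> and \<open>B A\<close> gives \<open>m = n\<close> in characteristic 0 without any dimension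
  theory.\<close>

lemma square_if_two_sided_inverse:
  fixes A B :: "'a :: field_char_0 mat"
  assumes A: "A \<in> carrier_mat m n" and B: "B \<in> carrier_mat n m"
    and AB: "A * B = 1\<^sub>m m" "B * A = 1\<^sub>m n"
  shows "m = n"
proof -
  have "of_nat m = (\<Sum>i = 0..<m. (A * B) $$ (i, i))"
    unfolding AB by simp
  also have "\<dots> = (\<Sum>i = 0..<m. \<Sum>j = 0..<n. A $$ (i, j) * B $$ (j, i))"
    using A B by (intro sum.cong index_mult_mat_sum) auto
  also have "\<dots> = (\<Sum>j = 0..<n. \<Sum>i = 0..<m. B $$ (j, i) * A $$ (i, j))"
    by (subst sum.swap) (simp add: mult.commute)
  also have "\<dots> = (\<Sum>j = 0..<n. (B * A) $$ (j, j))"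
    using A B by (intro sum.cong index_mult_mat_sum[symmetric]) auto
  also have "\<dots> = of_nat n" unfolding AB by simp
  finally show ?thesis by simp
qed

text \<open>The columns of \<open>X\<close> are eigenvectors of \<open>M\<close> or zero, and they span because \<open>X\<close> has the right inverse
  \<open>R\<close>. A basis need not be selected by an exchange argument: the rows of \<open>N\<close> are, up to scaling, dual
  to the nonzero columns of \<open>X\<close>, so these columns alone form a matrix with inverses on both sides,
  which is square.\<close>

lemma diagonalizable_if_eigenvectors:
  fixes M :: "'a :: field_char_0 mat"
  assumes M: "M \<in> carrier_mat p p" and X: "X \<in> carrier_mat p n"
    and R: "R \<in> carrier_mat n p" "X * R = 1\<^sub>m p"
    and N: "N \<in> carrier_mat n p" "diagonal_mat (N * X)"
    and zero: "\<And>i a. i < n \<Longrightarrow> a < p \<Longrightarrow> (N * X) $$ (i, i) = 0 \<Longrightarrow> X $$ (a, i) = 0"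
    and L: "L \<in> carrier_mat n n" "diagonal_mat L" "M * X = X * L"
  shows "\<exists>E. diagonal_mat E \<and> similar_mat M E"
proof -
  define S where "S = {i. i < n \<and> (N * X) $$ (i, i) \<noteq> 0}"
  define s where "s = card S"
  obtain f where f: "bij_betw f {0..<s} S"
    using ex_bij_betw_nat_finite[of S] unfolding s_def S_def by auto
  have fn: "f b < n" "(N * X) $$ (f b, f b) \<noteq> 0" if "b < s" for b
    using bij_betwE[OF f] that unfolding S_def by auto
  have finj: "f b = f c \<longleftrightarrow> b = c" if "b < s" "c < s" for b c
    using inj_on_eq_iff[OF bij_betw_imp_inj_on[OF f], of b c] that by auto
  define XS where "XS = mat p s (\<lambda>(a, b). X $$ (a, f b))"
  define RS where "RS = mat s p (\<lambda>(b, a). R $$ (f b, a))"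
  define NS where "NS = mat s p (\<lambda>(b, a). N $$ (f b, a) / (N * X) $$ (f b, f b))"
  define LS where "LS = mat s s (\<lambda>(b, c). if b = c then L $$ (f b, f b) else 0)"
  have car: "XS \<in> carrier_mat p s" "RS \<in> carrier_mat s p" "NS \<in> carrier_mat s p" "LS \<in> carrier_mat s s"
    unfolding XS_def RS_def NS_def LS_def by auto
  have XR: "XS * RS = 1\<^sub>m p"
  proof (rule eq_matI)
    fix a c assume "a < dim_row (1\<^sub>m p :: 'a mat)" "c < dim_col (1\<^sub>m p :: 'a mat)"
    then have ac: "a < p" "c < p" by auto
    have "(XS * RS) $$ (a, c) = (\<Sum>b = 0..<s. XS $$ (a, b) * RS $$ (b, c))"
      using car ac by (intro index_mult_mat_sum) auto
    also have "\<dots> = (\<Sum>b = 0..<s. X $$ (a, f b) * R $$ (f b, c))"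
      using ac by (intro sum.cong) (auto simp: XS_def RS_def)
    \<comment> \<open>The columns left out of \<open>XS\<close> are zero, so the product is still \<open>X * R\<close>.\<close>
    also have "\<dots> = (\<Sum>i\<in>S. X $$ (a, i) * R $$ (i, c))"
      by (rule sum.reindex_bij_betw[OF f])
    also have "\<dots> = (\<Sum>i = 0..<n. X $$ (a, i) * R $$ (i, c))"
      using zero ac by (intro sum.mono_neutral_left) (auto simp: S_def simp del: index_mult_mat(1))
    also have "\<dots> = (X * R) $$ (a, c)"
      using X R(1) ac by (intro index_mult_mat_sum[symmetric]) auto
    finally show "(XS * RS) $$ (a, c) = 1\<^sub>m p $$ (a, c)" using R(2) by simp
  qed (use car in auto)
  have NX: "NS * XS = 1\<^sub>m s"
  proof (rule eq_matI)
    fix b c assume "b < dim_row (1\<^sub>m s :: 'a mat)" "c < dim_col (1\<^sub>m s :: 'a mat)"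
    then have bc: "b < s" "c < s" by auto
    have "(NS * XS) $$ (b, c) = (\<Sum>a = 0..<p. NS $$ (b, a) * XS $$ (a, c))"
      using car bc by (intro index_mult_mat_sum) auto
    also have "\<dots> = (\<Sum>a = 0..<p. N $$ (f b, a) * X $$ (a, f c)) / (N * X) $$ (f b, f b)"
      unfolding sum_divide_distrib using bc
      by (intro sum.cong) (auto simp: XS_def NS_def simp del: index_mult_mat(1))
    also have "(\<Sum>a = 0..<p. N $$ (f b, a) * X $$ (a, f c)) = (N * X) $$ (f b, f c)"
      using N(1) X fn bc by (intro index_mult_mat_sum[symmetric]) auto
    also have "(N * X) $$ (f b, f c) / (N * X) $$ (f b, f b) = 1\<^sub>m s $$ (b, c)"
    proof (cases "b = c")
      case True
      then show ?thesis using fn(2)[OF bc(1)] bc by (simp del: index_mult_mat(1))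
    next
      case False
      then have "(N * X) $$ (f b, f c) = 0"
        using N fn(1) bc finj[OF bc] X unfolding diagonal_mat_def by (simp del: index_mult_mat(1))
      then show ?thesis using False bc by (simp del: index_mult_mat(1))
    qed
    finally show "(NS * XS) $$ (b, c) = 1\<^sub>m s $$ (b, c)" .
  qed (use car in auto)
  \<comment> \<open>A left and a right inverse of \<open>XS\<close> coincide, even before \<open>XS\<close> is known to be square.\<close>
  have "RS = (NS * XS) * RS" using NX car by simp
  also have "\<dots> = NS * (XS * RS)" using car by simp
  also have "\<dots> = NS" using XR car by simp
  finally have RX: "RS * XS = 1\<^sub>m s" using NX by simp
  have ps: "p = s" by (rule square_if_two_sided_inverse[OF car(1,2) XR RX])
  have MX: "M * XS = XS * LS"
  proof (rule eq_matI)
    fix a b assume "a < dim_row (XS * LS)" "b < dim_col (XS * LS)"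
    then have ab: "a < p" "b < s" using car by auto
    have LSd: "diagonal_mat LS" unfolding LS_def diagonal_mat_def by auto
    have "(M * XS) $$ (a, b) = (\<Sum>c = 0..<p. M $$ (a, c) * XS $$ (c, b))"
      using car M ab by (intro index_mult_mat_sum) auto
    also have "\<dots> = (\<Sum>c = 0..<p. M $$ (a, c) * X $$ (c, f b))"
      using ab by (intro sum.cong) (auto simp: XS_def)
    also have "\<dots> = (M * X) $$ (a, f b)"
      using M X ab fn by (intro index_mult_mat_sum[symmetric]) auto
    also have "\<dots> = X $$ (a, f b) * L $$ (f b, f b)"
      unfolding L(3) using L X ab fn by (intro diagonal_mult_index) auto
    also have "\<dots> = (XS * LS) $$ (a, b)"
      using ab by (subst diagonal_mult_index[OF car(4) LSd car(1)]) (auto simp: XS_def LS_def)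
    finally show "(M * XS) $$ (a, b) = (XS * LS) $$ (a, b)" .
  qed (use car M in auto)
  have "M = M * (XS * RS)" using XR M by simp
  also have "\<dots> = M * XS * RS" using M car by simp
  also have "\<dots> = XS * LS * RS" unfolding MX ..
  finally have "similar_mat M LS"
    using car M XR RX ps by (intro similar_matI[of _ _ XS RS p]) auto
  moreover have "diagonal_mat LS" unfolding LS_def diagonal_mat_def by auto
  ultimately show ?thesis by blast
qed

text \<open>With \<open>Q = P\<inverse>\<close> one has \<open>A P = Q\<^sup>T D\<close> and \<open>B P = Q\<^sup>T E\<close>, and diagonal matrices commute. Columnwise
  the second identity says that each column \<open>v\<close> of \<open>P\<close> satisfies \<open>\<epsilon> A v = \<delta> B v\<close>, where \<open>\<delta>\<close> and
  \<open>\<epsilon>\<close> are the corresponding diagonal entries of \<open>D\<close> and \<open>E\<close>.\<close>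

lemma diagonal_congruence_pencil:
  fixes A B :: "'a :: comm_ring_1 mat"
  assumes A: "A \<in> carrier_mat n n" and B: "B \<in> carrier_mat n n"
    and P: "P \<in> carrier_mat n n" "Q \<in> carrier_mat n n" "P * Q = 1\<^sub>m n"
    and D: "D = transpose_mat P * A * P" "diagonal_mat D"
    and E: "E = transpose_mat P * B * P" "diagonal_mat E"
  shows "A * P = transpose_mat Q * D" "A * P * E = B * P * D"
proof -
  have QP: "transpose_mat Q * transpose_mat P = 1\<^sub>m n"
    using transpose_mult[OF P(1,2)] P(3) by simp
  have undo: "H * P = transpose_mat Q * (transpose_mat P * H * P)" if "H \<in> carrier_mat n n" for H
  proof -
    have "H * P = (transpose_mat Q * transpose_mat P) * (H * P)" using QP P that by simp
    then show ?thesis using P that by (simp add: assoc_mult_mat[of _ n n _ n _ n])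
  qed
  show AP: "A * P = transpose_mat Q * D" unfolding D by (rule undo[OF A])
  have BP: "B * P = transpose_mat Q * E" unfolding E by (rule undo[OF B])
  have car: "D \<in> carrier_mat n n" "E \<in> carrier_mat n n" using A B P D E by auto
  have "A * P * E = transpose_mat Q * (D * E)"
    unfolding AP using P(2) car by (simp add: assoc_mult_mat[of _ n n _ n _ n])
  also have "\<dots> = transpose_mat Q * (E * D)"
    using diagonal_mat_commute[OF car(1) D(2) car(2) E(2)] by simp
  also have "\<dots> = B * P * D"
    unfolding BP using P(2) car by (simp add: assoc_mult_mat[of _ n n _ n _ n])
  finally show "A * P * E = B * P * D" .
qed

text \<open>A row supported on the first \<open>p\<close> columns sees only the first \<open>p\<close> rows of the other factor. This turns
  the block structure into statements about the upper part of \<open>P\<close>.\<close>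

lemma leading_rows_mult:
  fixes H P :: "'a :: semiring_0 mat"
  assumes "H \<in> carrier_mat n n" "P \<in> carrier_mat n n" "G \<in> carrier_mat m p" "c < n" "a < m" "i < n" "p \<le> n"
    and H: "\<And>j. j < n \<Longrightarrow> H $$ (c, j) = (if j < p then G $$ (a, j) else 0)"
  shows "(H * P) $$ (c, i) = (G * mat p n (($$) P)) $$ (a, i)"
proof -
  have "(H * P) $$ (c, i) = (\<Sum>j = 0..<n. H $$ (c, j) * P $$ (j, i))"
    using assms by (intro index_mult_mat_sum) auto
  also have "\<dots> = (\<Sum>j = 0..<p. G $$ (a, j) * P $$ (j, i))"
    using H assms(7) by (intro sum.mono_neutral_cong_right) auto
  also have "\<dots> = (\<Sum>j = 0..<p. G $$ (a, j) * mat p n (($$) P) $$ (j, i))"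
    using assms by (intro sum.cong) auto
  also have "\<dots> = (G * mat p n (($$) P)) $$ (a, i)"
    using assms by (intro index_mult_mat_sum[symmetric]) auto
  finally show ?thesis .
qed

text \<open>Let \<open>X\<close> be the upper \<open>p\<close> rows of \<open>P\<close> and let \<open>x\<close> be a column of \<open>X\<close>. If \<open>\<delta> = 0\<close>, then the
  corresponding column of \<open>A P = Q\<^sup>T D\<close> vanishes, so \<open>A\<^sub>1 x = 0\<close> and \<open>x = 0\<close>. If \<open>\<delta> \<noteq> 0\<close>, then the lower
  rows of \<open>\<epsilon> A v = \<delta> B v\<close> give \<open>B\<^sub>2\<^sup>T x = 0\<close>. So \<open>B\<^sub>2\<^sup>T X = 0\<close>, and \<open>B\<^sub>2 = 0\<close> because \<open>X\<close> has a right
  inverse. The upper rows then say that \<open>x\<close> is an eigenvector of \<open>A\<^sub>1\<inverse> B\<^sub>1\<close> for the eigenvalue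
  \<open>\<epsilon> / \<delta>\<close>, and \<open>X\<^sup>T A\<^sub>1 X = D\<close> supplies the dual rows \<open>X\<^sup>T A\<^sub>1\<close>.\<close>

lemma diagonalizable_if_simultaneous_congruence:
  fixes A B A1 A1' B1 B2 :: "real mat"
  assumes A: "A \<in> carrier_mat n n" and B: "B \<in> carrier_mat n n"
    and A1: "A1 \<in> carrier_mat p p" "A1' \<in> carrier_mat p p" "A1' * A1 = 1\<^sub>m p"
    and B1: "B1 \<in> carrier_mat p p" and B2: "B2 \<in> carrier_mat p r" and pm: "m + r = n" "p \<le> m"
    and A_index: "\<And>a j. a < n \<Longrightarrow> j < n \<Longrightarrow> A $$ (a, j) = (if a < p \<and> j < p then A1 $$ (a, j) else 0)"
    and B_top: "\<And>a j. a < p \<Longrightarrow> j < n \<Longrightarrow>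
        B $$ (a, j) = (if j < p then B1 $$ (a, j) else if j < m then 0 else B2 $$ (a, j - m))"
    and B_bottom: "\<And>b j. b < r \<Longrightarrow> j < n \<Longrightarrow> B $$ (m + b, j) = (if j < p then B2 $$ (j, b) else 0)"
    and SD: "simultaneously_diagonalizable_via_congruence n {A, B}"
  shows "B2 = 0\<^sub>m p r" "has_diagonal_jordan_nf (A1' * B1)"
proof -
  obtain P where P: "P \<in> carrier_mat n n" "invertible_mat P"
    and dD: "diagonal_mat (transpose_mat P * A * P)" and dE: "diagonal_mat (transpose_mat P * B * P)"
    using SD unfolding simultaneously_diagonalizable_via_congruence_def by blast
  obtain Q where Q: "Q \<in> carrier_mat n n" "P * Q = 1\<^sub>m n" "Q * P = 1\<^sub>m n"
    using invertible_mat_obtain_inverse[OF P] .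
  define D where "D = transpose_mat P * A * P"
  define E where "E = transpose_mat P * B * P"
  have car: "D \<in> carrier_mat n n" "E \<in> carrier_mat n n" using A B P D_def E_def by auto
  note dD = dD[folded D_def] and dE = dE[folded E_def]
  note AP = diagonal_congruence_pencil(1)[OF A B P(1) Q(1,2) D_def dD E_def dE]
  note pencil = diagonal_congruence_pencil(2)[OF A B P(1) Q(1,2) D_def dD E_def dE]
  define X where "X = mat p n (($$) P)"
  define R where "R = mat n p (($$) Q)"
  have X: "X \<in> carrier_mat p n" and R: "R \<in> carrier_mat n p" unfolding X_def R_def by auto
  have XR: "X * R = 1\<^sub>m p"
  proof (rule eq_matI)
    fix a c assume "a < dim_row (1\<^sub>m p :: real mat)" "c < dim_col (1\<^sub>m p :: real mat)"
    then have ac: "a < p" "c < p" by auto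
    have "(X * R) $$ (a, c) = (\<Sum>i = 0..<n. X $$ (a, i) * R $$ (i, c))"
      using X R ac by (intro index_mult_mat_sum) auto
    also have "\<dots> = (\<Sum>i = 0..<n. P $$ (a, i) * Q $$ (i, c))"
      using ac by (intro sum.cong) (auto simp: X_def R_def)
    also have "\<dots> = (P * Q) $$ (a, c)"
      using ac pm by (intro index_mult_mat_sum[OF P(1) Q(1), symmetric]) simp_all
    finally show "(X * R) $$ (a, c) = 1\<^sub>m p $$ (a, c)" using Q(2) ac pm by simp
  qed (use X R in auto)
  have AX: "(A * P) $$ (a, i) = (A1 * X) $$ (a, i)" if "a < p" "i < n" for a i
    unfolding X_def using A P(1) A1(1) A_index that pm
    by (intro leading_rows_mult) auto
  have AX0: "(A * P) $$ (a, i) = 0" if "p \<le> a" "a < n" "i < n" for a i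
    using that A P(1) A_index by (subst index_mult_mat_sum[of _ n n _ n]) auto
  have X_zero: "X $$ (a, i) = 0" if "i < n" "a < p" "D $$ (i, i) = 0" for i a
  proof -
    have "(A1 * X) $$ (c, i) = 0" if "c < p" for c
      using AX[OF that \<open>i < n\<close>] diagonal_mult_index[OF car(1) dD, of "transpose_mat Q" n c i] Q(1)
        \<open>i < n\<close> \<open>D $$ (i, i) = 0\<close> that pm unfolding AP by (simp del: index_mult_mat(1))
    moreover have "X = A1' * (A1 * X)"
      using assoc_mult_mat[OF A1(2,1) X] left_mult_one_mat[OF X] A1(3) by simp
    moreover have "(A1' * (A1 * X)) $$ (a, i) = (\<Sum>c = 0..<p. A1' $$ (a, c) * (A1 * X) $$ (c, i))"
      using A1 X that by (intro index_mult_mat_sum mult_carrier_mat[of _ p p]) auto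
    ultimately show ?thesis by simp
  qed
  have pencil_index: "(A * P) $$ (a, i) * E $$ (i, i) = (B * P) $$ (a, i) * D $$ (i, i)"
    if "a < n" "i < n" for a i
    using arg_cong[OF pencil, of "\<lambda>M. M $$ (a, i)"] that
      diagonal_mult_index[OF car(1) dD, of "B * P" n a i] diagonal_mult_index[OF car(2) dE, of "A * P" n a i]
      A B P(1) by (simp del: index_mult_mat(1))
  have "transpose_mat B2 * X = 0\<^sub>m r n"
  proof (rule eq_matI)
    fix b i assume "b < dim_row (0\<^sub>m r n :: real mat)" "i < dim_col (0\<^sub>m r n :: real mat)"
    then have bi: "b < r" "i < n" by auto
    show "(transpose_mat B2 * X) $$ (b, i) = 0\<^sub>m r n $$ (b, i)"
    proof (cases "D $$ (i, i) = 0")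
      case True
      then show ?thesis
        using X_zero bi X B2 by (subst index_mult_mat_sum[of _ r p _ n]) auto
    next
      case False
      have "(B * P) $$ (m + b, i) = (transpose_mat B2 * X) $$ (b, i)"
        unfolding X_def using B P(1) B2 B_bottom bi pm by (intro leading_rows_mult) auto
      moreover have "(B * P) $$ (m + b, i) * D $$ (i, i) = 0"
        using pencil_index[of "m + b" i] AX0[of "m + b" i] bi pm by simp
      ultimately show ?thesis using False bi by simp
    qed
  qed (use X B2 in auto)
  then have "transpose_mat B2 * (X * R) = 0\<^sub>m r p"
    using assoc_mult_mat[of "transpose_mat B2" r p X n R p] X R B2 by simp
  then have "transpose_mat B2 = transpose_mat (0\<^sub>m p r)"
    unfolding XR using B2 by simp
  then show B2_zero: "B2 = 0\<^sub>m p r" by (simp only: transpose_mat_eq)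
  have BX: "(B * P) $$ (a, i) = (B1 * X) $$ (a, i)" if "a < p" "i < n" for a i
    unfolding X_def using B P(1) B1 B_top that pm B2_zero
    by (intro leading_rows_mult) auto
  \<comment> \<open>Where \<open>D\<close> has a zero entry, division by zero puts eigenvalue \<open>0\<close> on a zero column of \<open>X\<close>.\<close>
  define L where "L = mat n n (\<lambda>(i, j). if i = j then E $$ (i, i) / D $$ (i, i) else 0)"
  have L: "L \<in> carrier_mat n n" "diagonal_mat L" unfolding L_def diagonal_mat_def by auto
  have "B1 * X = A1 * X * L"
  proof (rule eq_matI)
    fix a i assume "a < dim_row (A1 * X * L)" "i < dim_col (A1 * X * L)"
    then have ai: "a < p" "i < n" using A1 L by auto
    have r: "(A1 * X * L) $$ (a, i) = (A1 * X) $$ (a, i) * (E $$ (i, i) / D $$ (i, i))"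
      using A1 X ai diagonal_mult_index[OF L, of "A1 * X" p a i]
      by (simp add: L_def del: index_mult_mat(1))
    show "(B1 * X) $$ (a, i) = (A1 * X * L) $$ (a, i)"
    proof (cases "D $$ (i, i) = 0")
      case True
      then have "(B1 * X) $$ (a, i) = 0"
        using X_zero ai X B1 by (subst index_mult_mat_sum[of _ p p _ n]) auto
      then show ?thesis unfolding r using True by simp
    next
      case False
      then show ?thesis
        unfolding r using pencil_index[of a i] AX[OF ai] BX[OF ai] ai pm
        by (simp add: field_simps del: index_mult_mat(1))
    qed
  qed (use A1 B1 X L in auto)
  then have "A1' * (B1 * X) = (A1' * A1) * X * L"
    using A1(1,2) X L(1) by (simp add: assoc_mult_mat[of _ p p _ n _ n] assoc_mult_mat[of _ p p _ p _ n])
  then have MX: "A1' * B1 * X = X * L"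
    unfolding A1(3) using A1(2) B1 X by simp
  have NX: "transpose_mat X * A1 * X = D"
  proof (rule eq_matI)
    fix i j assume "i < dim_row D" "j < dim_col D"
    then have ij: "i < n" "j < n" using car by auto
    have "transpose_mat X * A1 * X = transpose_mat X * (A1 * X)" using A1 X by simp
    then have "(transpose_mat X * A1 * X) $$ (i, j) = (\<Sum>a = 0..<p. transpose_mat X $$ (i, a) * (A1 * X) $$ (a, j))"
      using A1 X ij by (simp only:) (intro index_mult_mat_sum, auto)
    also have "\<dots> = (\<Sum>a = 0..<n. transpose_mat P $$ (i, a) * (A * P) $$ (a, j))"
      using ij pm P(1) AX0 AX
      by (intro sum.mono_neutral_cong_left) (auto simp: X_def simp del: index_mult_mat(1))
    also have "\<dots> = (transpose_mat P * (A * P)) $$ (i, j)"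
      using A P ij by (intro index_mult_mat_sum[symmetric]) auto
    also have "transpose_mat P * (A * P) = D" using A P by (simp add: D_def)
    finally show "(transpose_mat X * A1 * X) $$ (i, j) = D $$ (i, j)" .
  qed (use X car in auto)
  show "has_diagonal_jordan_nf (A1' * B1)"
    unfolding has_diagonal_jordan_nf_iff
  proof (rule diagonalizable_if_eigenvectors[OF _ X R XR _ _ _ L MX])
    show "A1' * B1 \<in> carrier_mat p p" "transpose_mat X * A1 \<in> carrier_mat n p"
      using A1(1,2) B1 X by auto
    show "diagonal_mat (transpose_mat X * A1 * X)" unfolding NX by (rule dD)
    show "X $$ (a, i) = 0" if "i < n" "a < p" "(transpose_mat X * A1 * X) $$ (i, i) = 0" for i a
      using X_zero that unfolding NX by blast
  qed
qed

section \<open>Pairs in block form\<close>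

lemma diagonal_four_block_mat:
  assumes "G \<in> carrier_mat p p" "K \<in> carrier_mat k k" "diagonal_mat G" "diagonal_mat K"
  shows "diagonal_mat (four_block_mat G (0\<^sub>m p k) (0\<^sub>m k p) K)"
  using assms unfolding diagonal_mat_def by auto

text \<open>Acting by \<open>T\<close> on the leading block only: the trailing blocks of the two given matrices are already
  diagonal.\<close>

lemma congruence_four_block_diag:
  fixes T G K :: "'a :: comm_ring_1 mat"
  assumes "T \<in> carrier_mat p p" "G \<in> carrier_mat p p" "K \<in> carrier_mat k k"
  defines "W \<equiv> four_block_mat T (0\<^sub>m p k) (0\<^sub>m k p) (1\<^sub>m k)"
  shows "transpose_mat W * four_block_mat G (0\<^sub>m p k) (0\<^sub>m k p) K * W
    = four_block_mat (transpose_mat T * G * T) (0\<^sub>m p k) (0\<^sub>m k p) K"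
proof -
  have "transpose_mat W = four_block_mat (transpose_mat T) (0\<^sub>m p k) (0\<^sub>m k p) (1\<^sub>m k)"
    unfolding W_def using assms(1) by (subst transpose_four_block_mat[of _ p p _ k _ k]) auto
  then have "transpose_mat W * four_block_mat G (0\<^sub>m p k) (0\<^sub>m k p) K
      = four_block_mat (transpose_mat T * G) (0\<^sub>m p k) (0\<^sub>m k p) K"
    using assms(1-3) by (simp add: mult_four_block_mat[of _ p p _ k _ k _ _ p _ k])
  then show ?thesis
    unfolding W_def using assms(1-3) by (simp add: mult_four_block_mat[of _ p p _ k _ k _ _ p _ k])
qed

lemma invertible_four_block_diag:
  fixes T T' :: "'a :: comm_ring_1 mat"
  assumes "T \<in> carrier_mat p p" "T' \<in> carrier_mat p p" "T * T' = 1\<^sub>m p" "T' * T = 1\<^sub>m p"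
  shows "invertible_mat (four_block_mat T (0\<^sub>m p k) (0\<^sub>m k p) (1\<^sub>m k))"
  using assms
  by (intro invertible_mat_if_inverse[of _ "p + k" "four_block_mat T' (0\<^sub>m p k) (0\<^sub>m k p) (1\<^sub>m k)"])
    (auto simp: mult_four_block_mat[of _ p p _ k _ k _ _ p _ k])

theorem theorem2p6:
  fixes A B U A1 B1 B2 B3 :: "real mat" and n p q r :: nat
  assumes "n = p + q + r"
    and "A \<in> carrier_mat n n" "transpose_mat A = A" "\<not> invertible_mat A"
    and "B \<in> carrier_mat n n" "transpose_mat B = B" "\<not> invertible_mat B"
    and "U \<in> carrier_mat n n" "invertible_mat U"
    and "A1 \<in> carrier_mat p p" "diagonal_mat A1" "invertible_mat A1"
    and "B1 \<in> carrier_mat p p"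
    and "B2 \<in> carrier_mat p r"
    and "B3 \<in> carrier_mat q q" "diagonal_mat B3" "invertible_mat B3"
    and "transpose_mat U * A * U =
           four_block_mat A1 (0\<^sub>m p (n - p)) (0\<^sub>m (n - p) p) (0\<^sub>m (n - p) (n - p))"
    and "transpose_mat U * B * U =
           four_block_mat
             (four_block_mat B1 (0\<^sub>m p q) (0\<^sub>m q p) B3)
             (B2 @\<^sub>r 0\<^sub>m q r)
             (transpose_mat (B2 @\<^sub>r 0\<^sub>m q r))
             (0\<^sub>m r r)"
  shows "simultaneously_diagonalizable_via_congruence n {A, B} \<longleftrightarrow>
           has_diagonal_jordan_nf (the (mat_inverse A1) * B1) \<and> (B2 = 0\<^sub>m p r \<or> r = 0)"
proof -
  define A' where "A' = transpose_mat U * A * U"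
  define B' where "B' = transpose_mat U * B * U"
  note n = assms(1) and U = assms(8,9) and A1 = assms(10-12) and B1 = assms(13) and B2 = assms(14)
    and B3 = assms(15,16)
  note A'_eq = assms(18)[folded A'_def] and B'_eq = assms(19)[folded B'_def]
  define A1' where "A1' = the (mat_inverse A1)"
  note A1' = the_mat_inverse[OF A1(1,3), folded A1'_def]
  have car: "A' \<in> carrier_mat n n" "B' \<in> carrier_mat n n"
    unfolding A'_def B'_def using U(1) assms(2,5) by auto
  have SD_iff: "simultaneously_diagonalizable_via_congruence n {A, B}
      \<longleftrightarrow> simultaneously_diagonalizable_via_congruence n {A', B'}"
    using simultaneously_diagonalizable_congruence_iff[OF U, of "{A, B}"] assms(2,5)
    by (simp add: A'_def B'_def)
  have B'T: "transpose_mat B' = B'"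
    unfolding B'_def using U(1) assms(5,6)
    by (simp add: transpose_mult[of _ n n _ n] assoc_mult_mat[of _ n n _ n _ n])
  have B'_11: "B' $$ (a, j) = B1 $$ (a, j)" if "a < p" "j < p" for a j
    unfolding B'_eq using that B1 B2 B3 n by simp
  have B1T: "transpose_mat B1 = B1"
  proof (rule eq_matI)
    fix a j assume "a < dim_row B1" "j < dim_col B1"
    then have aj: "a < p" "j < p" using B1 by auto
    have "B' $$ (j, a) = B' $$ (a, j)"
      using arg_cong[OF B'T, of "\<lambda>M. M $$ (a, j)"] aj car(2) n by simp
    then show "transpose_mat B1 $$ (a, j) = B1 $$ (a, j)"
      using aj B1 B'_11 by simp
  qed (use B1 in auto)
  have A1T: "transpose_mat A1 = A1" by (rule diagonal_mat_transpose[OF A1(1,2)])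
  have A1B1: "A1 * (A1' * B1) = B1"
    using A1(1) A1' B1 by (metis assoc_mult_mat left_mult_one_mat)
  show ?thesis
    unfolding SD_iff A1'_def[symmetric]
  proof
    assume SD: "simultaneously_diagonalizable_via_congruence n {A', B'}"
    have A'_index: "A' $$ (a, j) = (if a < p \<and> j < p then A1 $$ (a, j) else 0)" if "a < n" "j < n" for a j
      unfolding A'_eq using that A1(1) n by auto
    have B'_top: "B' $$ (a, j) = (if j < p then B1 $$ (a, j) else if j < p + q then 0 else B2 $$ (a, j - (p + q)))"
      if "a < p" "j < n" for a j
      unfolding B'_eq append_rows_def using that B1 B2 B3 n by auto
    have B'_bottom: "B' $$ (p + q + b, j) = (if j < p then B2 $$ (j, b) else 0)" if "b < r" "j < n" for b j
      unfolding B'_eq append_rows_def using that B1 B2 B3 n by auto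
    show "has_diagonal_jordan_nf (A1' * B1) \<and> (B2 = 0\<^sub>m p r \<or> r = 0)"
      using diagonalizable_if_simultaneous_congruence[OF car A1(1) A1'(1,3) B1 B2 n[symmetric] _
          A'_index B'_top B'_bottom SD] by simp
  next
    assume r: "has_diagonal_jordan_nf (A1' * B1) \<and> (B2 = 0\<^sub>m p r \<or> r = 0)"
    \<comment> \<open>For \<open>r = 0\<close> the matrix \<open>B2\<close> has no columns and equals the empty zero matrix.\<close>
    then have B2_zero: "B2 = 0\<^sub>m p r" using B2 by auto
    obtain D where D: "diagonal_mat D" "similar_mat (A1' * B1) D"
      using r unfolding has_diagonal_jordan_nf_iff by blast
    obtain T T' where T: "T \<in> carrier_mat p p" "T' \<in> carrier_mat p p" "T * T' = 1\<^sub>m p" "T' * T = 1\<^sub>m p"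
      "diagonal_mat (transpose_mat T * A1 * T)" "diagonal_mat (transpose_mat T * B1 * T)"
      using simultaneous_congruence_if_diagonalizable[of A1 p "A1' * B1" D] A1(1) A1T A1'(1) B1 B1T A1B1 D
      by auto
    define K where "K = four_block_mat B3 (0\<^sub>m q r) (0\<^sub>m r q) (0\<^sub>m r r)"
    have K: "K \<in> carrier_mat (n - p) (n - p)" "diagonal_mat K"
      unfolding K_def using B3 n by (auto simp: diagonal_mat_def)
    have B'_diag: "B' = four_block_mat B1 (0\<^sub>m p (n - p)) (0\<^sub>m (n - p) p) K"
      unfolding B'_eq B2_zero K_def append_rows_def
      using B1 B3 n by (intro eq_matI) auto
    define W where "W = four_block_mat T (0\<^sub>m p (n - p)) (0\<^sub>m (n - p) p) (1\<^sub>m (n - p))"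
    have "W \<in> carrier_mat n n" "invertible_mat W"
      unfolding W_def using T n invertible_four_block_diag[OF T(1-4), of "n - p"] by auto
    moreover have "diagonal_mat (transpose_mat W * A' * W)"
      unfolding A'_eq W_def
      by (subst congruence_four_block_diag)
        (use T A1 in \<open>auto intro!: diagonal_four_block_mat simp: diagonal_mat_def[of "0\<^sub>m _ _"]\<close>)
    moreover have "diagonal_mat (transpose_mat W * B' * W)"
      unfolding B'_diag W_def
      by (subst congruence_four_block_diag) (use T B1 K in \<open>auto intro!: diagonal_four_block_mat\<close>)
    ultimately show "simultaneously_diagonalizable_via_congruence n {A', B'}"
      unfolding simultaneously_diagonalizable_via_congruence_def by blast
  qed
qed

end
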